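(* Let $K\ge 1$, $N\ge 2$ be integers and $p>0$. The Fleming-Viot process $(\eta_t)_{t\ge 0}$ on the complete graph, i.e. the Markov process on $E=\{\eta:\{1,\dots,K\}\to\mathbb{N} : \sum_{i=1}^K\eta(i)=N\}$ with generator $\mathcal{L}$ given in the context, admits a unique invariant probability measure $\nu_N$; this measure is reversible, and it is given, for every $\eta\in E$, by $$\nu_N(\{\eta\}) = Z^{-1}\prod_{i=1}^{K}\prod_{j=0}^{\eta(i)-1}\frac{N-1+Kpj}{j+1},$$ where $Z$ is a normalizing constant (empty products are equal to $1$).
   Context: Here $\mathbb{N}=\{0,1,2,\dots\}$. For $\eta\in E$ with $\eta(i)\neq 0$ and $i\ne j$, the configuration $T_{i\to j}\eta$ is defined by $T_{i\to j}\eta(i)=\eta(i)-1$, $T_{i\to j}\eta(j)=\eta(j)+1$ and $T_{i\to j}\eta(k)=\eta(k)$ for $k\notin\{i,j\}$; terms with $i=j$ contribute zero ($T_{i\to i}\eta=\eta$). The generator acts on functions $f:E\to\mathbb{R}$ by $$\mathcal{L}f(\eta)=\sum_{i=1}^{K}\eta(i)\sum_{j=1}^{K}\bigl(f(T_{i\to j}\eta)-f(\eta)\bigr)\left(\frac1K+p\,\frac{\eta(j)}{N-1}\right),$$ where terms with $\eta(i)=0$ are zero. A measure $\nu$ on $E$ is reversible if $\nu(\{\eta\})C(\eta,\xi)=\nu(\{\xi\})C(\xi,\eta)$ for all $\eta\ne\xi$, where $C(\eta,\xi)=\mathcal{L}\mathbf{1}_{\{\xi\}}(\eta)$ is the jump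 rate from $\eta$ to $\xi$. *)

theory Defs
  imports "HOL-Probability.Probability"
begin

text \<open>Sites are \<open>1, \<dots>, K\<close>; configurations are maps \<open>{1..K} \<rightarrow> \<nat>\<close>, made extensional so that
  each configuration is represented by exactly one function.\<close>

definition configs :: "nat \<Rightarrow> nat \<Rightarrow> (nat \<Rightarrow> nat) set" where
  "configs K N = {\<eta> \<in> {1..K} \<rightarrow>\<^sub>E UNIV. (\<Sum>i=1..K. \<eta> i) = N}"

text \<open>Meaningful for \<open>\<eta> i \<noteq> 0\<close> only; elsewhere the subtraction truncates.\<close>

definition move :: "nat \<Rightarrow> nat \<Rightarrow> (nat \<Rightarrow> nat) \<Rightarrow> (nat \<Rightarrow> nat)" where
  "move i j \<eta> = (if i = j then \<eta> else \<eta>(i := \<eta> i - 1, j := \<eta> j + 1))"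

text \<open>For \<open>\<eta> i = 0\<close> the factor \<open>real (\<eta> i)\<close> removes the (meaningless) term with \<open>move i j \<eta>\<close>.\<close>

definition fv_generator ::
    "nat \<Rightarrow> nat \<Rightarrow> real \<Rightarrow> ((nat \<Rightarrow> nat) \<Rightarrow> real) \<Rightarrow> ((nat \<Rightarrow> nat) \<Rightarrow> real)" where
  "fv_generator K N p f \<eta> =
     (\<Sum>i=1..K. real (\<eta> i) *
        (\<Sum>j=1..K. (f (move i j \<eta>) - f \<eta>) * (1 / real K + p * real (\<eta> j) / (real N - 1))))"

definition fv_rate :: "nat \<Rightarrow> nat \<Rightarrow> real \<Rightarrow> (nat \<Rightarrow> nat) \<Rightarrow> (nat \<Rightarrow> nat) \<Rightarrow> real" where
  "fv_rate K N p \<eta> \<xi> = fv_generator K N p (indicator {\<xi>}) \<eta>"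

text \<open>Transition semigroup \<open>P\<^sub>t f (\<eta>) = E\<^sub>\<eta>[f (\<eta>\<^sub>t)]\<close> of the Markov process with generator \<open>L\<close>. The state
  space \<open>configs K N\<close> is finite, and on it \<open>L f\<close> depends only on the values of \<open>f\<close> there; hence \<open>L\<close> is
  bounded, the semigroup is \<open>P\<^sub>t = exp (t L)\<close>, and the exponential series converges at every state.\<close>

definition fv_semigroup ::
    "nat \<Rightarrow> nat \<Rightarrow> real \<Rightarrow> real \<Rightarrow> ((nat \<Rightarrow> nat) \<Rightarrow> real) \<Rightarrow> ((nat \<Rightarrow> nat) \<Rightarrow> real)" where
  "fv_semigroup K N p t f \<eta> = (\<Sum>n. t ^ n / fact n * (fv_generator K N p ^^ n) f \<eta>)"

definition prob_on_configs :: "nat \<Rightarrow> nat \<Rightarrow> (nat \<Rightarrow> nat) measure \<Rightarrow> bool" where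
  "prob_on_configs K N \<nu> \<longleftrightarrow> prob_space \<nu> \<and> sets \<nu> = sets (count_space (configs K N))"

text \<open>\<open>\<nu> P\<^sub>t = \<nu>\<close> for all \<open>t \<ge> 0\<close>, tested against all functions (the state space is finite).\<close>

definition fv_invariant :: "nat \<Rightarrow> nat \<Rightarrow> real \<Rightarrow> (nat \<Rightarrow> nat) measure \<Rightarrow> bool" where
  "fv_invariant K N p \<nu> \<longleftrightarrow>
     (\<forall>t\<ge>0. \<forall>f. (\<integral>\<eta>. fv_semigroup K N p t f \<eta> \<partial>\<nu>) = (\<integral>\<eta>. f \<eta> \<partial>\<nu>))"

definition fv_reversible :: "nat \<Rightarrow> nat \<Rightarrow> real \<Rightarrow> (nat \<Rightarrow> nat) measure \<Rightarrow> bool" where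
  "fv_reversible K N p \<nu> \<longleftrightarrow>
     (\<forall>\<eta>\<in>configs K N. \<forall>\<xi>\<in>configs K N. \<eta> \<noteq> \<xi> \<longrightarrow>
        measure \<nu> {\<eta>} * fv_rate K N p \<eta> \<xi> = measure \<nu> {\<xi>} * fv_rate K N p \<xi> \<eta>)"

definition fv_weight :: "nat \<Rightarrow> nat \<Rightarrow> real \<Rightarrow> (nat \<Rightarrow> nat) \<Rightarrow> real" where
  "fv_weight K N p \<eta> =
     (\<Prod>i=1..K. \<Prod>j<\<eta> i. (real N - 1 + real K * p * real j) / (real j + 1))"

end

theory Submission
  imports Defs
begin

text \<open>The weight times the jump rate (the conductance) is the same for a jump and for its reversal, so the
  generator is self-adjoint for the weighted inner product. Testing this with indicators gives detailed
  balance, and testing it with the constant function \<open>1\<close> gives invariance. Conversely,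
  differentiating \<open>\<nu> P\<^sub>t = \<nu>\<close> at \<open>t = 0\<close> gives \<open>\<nu> L = 0\<close>; the Dirichlet form of the density of \<open>\<nu>\<close>
  with respect to the weight then vanishes, so the density is unchanged by every jump. All particles can
  be moved to site \<open>1\<close> one by one, hence the density is constant.\<close>

section \<open>Configurations, single jumps and integrals over finite spaces\<close>

lemma finite_configs: "finite (configs K N)"
proof (rule finite_subset)
  show "configs K N \<subseteq> {1..K} \<rightarrow>\<^sub>E {..N}"
  proof
    fix \<eta> assume \<eta>: "\<eta> \<in> configs K N"
    have "\<eta> i \<le> N" if "i \<in> {1..K}" for i
      using \<eta> member_le_sum[OF that, of \<eta>] by (simp add: configs_def)
    with \<eta> show "\<eta> \<in> {1..K} \<rightarrow>\<^sub>E {..N}"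
      by (auto simp: configs_def PiE_iff)
  qed
  show "finite ({1..K} \<rightarrow>\<^sub>E {..N})"
    by (intro finite_PiE) auto
qed

lemma sum_split_two:
  fixes f :: "nat \<Rightarrow> 'a :: comm_monoid_add"
  assumes "i \<in> {1..K}" "j \<in> {1..K}" "i \<noteq> j"
  shows "sum f {1..K} = f i + (f j + sum f ({1..K} - {i} - {j}))"
  using assms by (simp add: sum.remove[where x = i] sum.remove[where x = j])

lemma prod_split_two:
  fixes f :: "nat \<Rightarrow> 'a :: comm_monoid_mult"
  assumes "i \<in> {1..K}" "j \<in> {1..K}" "i \<noteq> j"
  shows "prod f {1..K} = f i * (f j * prod f ({1..K} - {i} - {j}))"
  using assms by (simp add: prod.remove[where x = i] prod.remove[where x = j])

lemma move_in_configs: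
  assumes \<eta>: "\<eta> \<in> configs K N" and ij: "i \<in> {1..K}" "j \<in> {1..K}" and "\<eta> i \<noteq> 0"
  shows "move i j \<eta> \<in> configs K N"
proof (cases "i = j")
  case False
  have "(\<Sum>k\<in>{1..K} - {i} - {j}. move i j \<eta> k) = (\<Sum>k\<in>{1..K} - {i} - {j}. \<eta> k)"
    by (intro sum.cong) (auto simp: move_def)
  then have "(\<Sum>k=1..K. move i j \<eta> k) = (\<Sum>k=1..K. \<eta> k)"
    using sum_split_two[OF ij False, of "move i j \<eta>"] sum_split_two[OF ij False, of \<eta>] False \<open>\<eta> i \<noteq> 0\<close>
    by (simp add: move_def)
  then show ?thesis
    using \<eta> ij by (auto simp: configs_def move_def PiE_iff extensional_def)
qed (use \<eta> in \<open>simp add: move_def\<close>)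

lemma move_back:
  assumes "\<eta> i \<noteq> 0"
  shows "move j i (move i j \<eta>) = \<eta>"
  using assms by (auto simp: move_def fun_eq_iff)

text \<open>On a finite space with all subsets measurable a finite measure is determined by its
  atoms. This turns every integral against \<open>\<nu>\<close> into a finite sum, so that the
  argument becomes linear algebra on \<open>E\<close>.\<close>

lemma lebesgue_integral_finite_count_space:
  fixes f :: "'a \<Rightarrow> real"
  assumes "finite A" and sets: "sets M = sets (count_space A)" and "finite_measure M"
  shows "(\<integral>x. f x \<partial>M) = (\<Sum>x\<in>A. f x * measure M {x})"
proof -
  interpret finite_measure M by fact
  have "M = point_measure A (\<lambda>x. ennreal (measure M {x}))"
    by (rule measure_eqI_finite[OF _ _ \<open>finite A\<close>])
      (auto simp: sets sets_point_measure emeasure_point_measure_finite \<open>finite A\<close> emeasure_eq_measure)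
  then have "(\<integral>x. f x \<partial>M) = (\<integral>x. f x \<partial>point_measure A (\<lambda>x. ennreal (measure M {x})))"
    by simp
  also have "\<dots> = (\<Sum>x\<in>A. f x * measure M {x})"
    by (subst lebesgue_integral_point_measure_finite) (auto simp: \<open>finite A\<close> mult.commute)
  finally show ?thesis .
qed

section \<open>The product weight and the balance of a single jump\<close>

locale fleming_viot =
  fixes K N :: nat and p :: real
  assumes K_ge_1: "K \<ge> 1" and N_ge_2: "N \<ge> 2" and p_pos: "p > 0"
begin

abbreviation E :: "(nat \<Rightarrow> nat) set" where "E \<equiv> configs K N"

abbreviation L :: "((nat \<Rightarrow> nat) \<Rightarrow> real) \<Rightarrow> (nat \<Rightarrow> nat) \<Rightarrow> real" where "L \<equiv> fv_generator K N p"

abbreviation w :: "(nat \<Rightarrow> nat) \<Rightarrow> real" where "w \<equiv> fv_weight K N p"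

text \<open>Rate at which one particle jumps to another site holding \<open>n\<close> particles: a
  uniform move, plus, at rate \<open>p\<close>, a jump onto one of the \<open>N - 1\<close> other
  particles.\<close>

definition inflow :: "nat \<Rightarrow> real" where
  "inflow n = 1 / real K + p * real n / (real N - 1)"

text \<open>With \<open>a = (N - 1) / (K p)\<close> this is
  \<open>(K p)^n a (a + 1) ... (a + n - 1) / n!\<close>, an unnormalised negative binomial weight.
  On \<open>E\<close> the product over the sites is therefore an unnormalised Dirichlet-multinomial
  law.\<close>

definition site_weight :: "nat \<Rightarrow> real" where
  "site_weight n = (\<Prod>j<n. (real N - 1 + real K * p * real j) / (real j + 1))"

text \<open>Empty departure sites, where \<open>move\<close> truncates, are left out so that every
  jump can be undone; pairs with \<open>i = j\<close> contribute nothing to the generator.\<close>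

definition jumps :: "((nat \<Rightarrow> nat) \<times> nat \<times> nat) set" where
  "jumps = {(\<eta>, i, j) \<in> E \<times> {1..K} \<times> {1..K}. i \<noteq> j \<and> \<eta> i \<noteq> 0}"

definition conductance :: "(nat \<Rightarrow> nat) \<Rightarrow> nat \<Rightarrow> nat \<Rightarrow> real" where
  "conductance \<eta> i j = w \<eta> * (real (\<eta> i) * inflow (\<eta> j))"

lemma inflow_pos: "inflow n > 0"
  using K_ge_1 N_ge_2 p_pos by (auto simp: inflow_def intro!: add_pos_nonneg)

lemma site_weight_pos: "site_weight n > 0"
proof -
  have "real N - 1 + real K * p * real j > 0" for j
    using N_ge_2 p_pos by (intro add_pos_nonneg) auto
  then show ?thesis
    unfolding site_weight_def by (intro prod_pos) simp
qed

lemma fv_weight_eq: "w \<eta> = (\<Prod>i=1..K. site_weight (\<eta> i))"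
  by (simp add: fv_weight_def site_weight_def)

lemma fv_weight_pos: "w \<eta> > 0"
  by (auto simp: fv_weight_eq intro!: prod_pos site_weight_pos)

text \<open>Balance at one site: departures from \<open>n + 1\<close> particles occur at rate
  \<open>n + 1\<close>, arrivals at \<open>n\<close> particles are governed by
  \<open>inflow n\<close>. The factor \<open>K (N - 1)\<close> clears the denominators of
  \<open>inflow\<close>; it cancels later because each conductance contains exactly one
  \<open>inflow\<close>.\<close>

lemma site_weight_Suc: "site_weight (Suc n) * real (Suc n) = site_weight n * (real K * (real N - 1) * inflow n)"
proof -
  have "real K * (real N - 1) * inflow n = real N - 1 + real K * p * real n"
    using K_ge_1 N_ge_2 by (simp add: inflow_def field_simps)
  then show ?thesis
    by (simp add: site_weight_def add.commute)
qed

text \<open>Only the sites \<open>i\<close> and \<open>j\<close> change, so the rest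
  \<open>R\<close> of the product is common to both sides. Applying the one-site balance at
  \<open>j\<close> and, in the opposite direction, at \<open>i\<close> matches the remaining
  factors.\<close>

lemma conductance_move:
  assumes ij: "i \<in> {1..K}" "j \<in> {1..K}" "i \<noteq> j" and "\<eta> i \<noteq> 0"
  shows "conductance (move i j \<eta>) j i = conductance \<eta> i j"
proof -
  let ?c = "real K * (real N - 1)"
  obtain a where a: "\<eta> i = Suc a" using \<open>\<eta> i \<noteq> 0\<close> by (cases "\<eta> i") auto
  define b R where "b = \<eta> j" and "R = (\<Prod>k\<in>{1..K} - {i} - {j}. site_weight (\<eta> k))"
  have R: "(\<Prod>k\<in>{1..K} - {i} - {j}. site_weight (move i j \<eta> k)) = R"
    unfolding R_def by (intro prod.cong) (auto simp: move_def)
  have w: "w \<eta> = site_weight (Suc a) * (site_weight b * R)"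
    using prod_split_two[OF ij, of "\<lambda>k. site_weight (\<eta> k)"] by (simp add: fv_weight_eq R_def a b_def)
  have w': "w (move i j \<eta>) = site_weight a * (site_weight (Suc b) * R)"
    using prod_split_two[OF ij, of "\<lambda>k. site_weight (move i j \<eta> k)"] ij
    unfolding R fv_weight_eq by (simp add: move_def a b_def)
  have mv: "move i j \<eta> i = a" "move i j \<eta> j = Suc b"
    using ij by (simp_all add: move_def a b_def)
  have c: "?c > 0" using K_ge_1 N_ge_2 by simp
  have "?c * conductance (move i j \<eta>) j i
      = (site_weight (Suc b) * real (Suc b)) * (site_weight a * (?c * inflow a)) * R"
    by (simp only: conductance_def w' mv mult_ac)
  also have "\<dots> = (site_weight b * (?c * inflow b)) * (site_weight (Suc a) * real (Suc a)) * R"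
    by (simp only: site_weight_Suc)
  also have "\<dots> = ?c * conductance \<eta> i j"
    by (simp only: conductance_def w a b_def[symmetric] mult_ac)
  finally show ?thesis by (rule mult_left_cancel[OF c[THEN less_imp_neq, symmetric], THEN iffD1])
qed

section \<open>Reversal of jumps, self-adjointness and the Dirichlet form\<close>

lemma finite_jumps: "finite jumps"
  by (rule finite_subset[of _ "E \<times> {1..K} \<times> {1..K}"]) (auto simp: jumps_def finite_configs)

text \<open>Reversing a jump is an involution of \<open>jumps\<close> that preserves the
  conductance; \<open>F\<close> is an arbitrary function of the two endpoints.\<close>

lemma sum_jumps_reverse:
  "(\<Sum>(\<eta>, i, j)\<in>jumps. conductance \<eta> i j * F \<eta> (move i j \<eta>)) =
   (\<Sum>(\<eta>, i, j)\<in>jumps. conductance \<eta> i j * F (move i j \<eta>) \<eta>)"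
proof (rule sum.reindex_bij_witness[where i = "\<lambda>(\<eta>, i, j). (move i j \<eta>, j, i)"
      and j = "\<lambda>(\<eta>, i, j). (move i j \<eta>, j, i)"])
  have target: "move i j \<eta> j \<noteq> 0" if "i \<noteq> j" for i j \<eta>
    using that by (simp add: move_def)
  show "(case x of (\<eta>, i, j) \<Rightarrow> (move i j \<eta>, j, i)) \<in> jumps" if "x \<in> jumps" for x
    using that target by (auto simp: jumps_def move_in_configs)
  then show "(case x of (\<eta>, i, j) \<Rightarrow> (move i j \<eta>, j, i)) \<in> jumps" if "x \<in> jumps" for x
    using that .
qed (auto simp: jumps_def move_back conductance_move)

lemma sum_weight_generator:
  "(\<Sum>\<eta>\<in>E. w \<eta> * (h \<eta> * L f \<eta>)) =
   (\<Sum>(\<eta>, i, j)\<in>jumps. conductance \<eta> i j * (h \<eta> * (f (move i j \<eta>) - f \<eta>)))"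
proof -
  have "(\<Sum>\<eta>\<in>E. w \<eta> * (h \<eta> * L f \<eta>)) =
      (\<Sum>\<eta>\<in>E. \<Sum>i=1..K. \<Sum>j=1..K. conductance \<eta> i j * (h \<eta> * (f (move i j \<eta>) - f \<eta>)))"
    by (simp add: fv_generator_def conductance_def inflow_def[symmetric] sum_distrib_left mult_ac)
  also have "\<dots> = (\<Sum>(\<eta>, i, j)\<in>E \<times> {1..K} \<times> {1..K}.
      conductance \<eta> i j * (h \<eta> * (f (move i j \<eta>) - f \<eta>)))"
    by (simp add: sum.cartesian_product)
  \<comment> \<open>The discarded triples vanish: for \<open>i = j\<close> the increment of
    \<open>f\<close> is zero, and for \<open>\<eta> i = 0\<close> the conductance is zero.\<close>
  also have "\<dots> = (\<Sum>(\<eta>, i, j)\<in>jumps. conductance \<eta> i j * (h \<eta> * (f (move i j \<eta>) - f \<eta>)))"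
    by (rule sum.mono_neutral_right)
      (auto simp: jumps_def finite_configs conductance_def move_def)
  finally show ?thesis .
qed

lemma generator_self_adjoint:
  "(\<Sum>\<eta>\<in>E. w \<eta> * (h \<eta> * L f \<eta>)) = (\<Sum>\<eta>\<in>E. w \<eta> * (f \<eta> * L h \<eta>))"
proof -
  \<comment> \<open>The diagonal terms \<open>h \<eta> * f \<eta>\<close> occur on both sides and
    cancel; reversal identifies the two remaining sums.\<close>
  have "(\<Sum>\<eta>\<in>E. w \<eta> * (h \<eta> * L f \<eta>)) - (\<Sum>\<eta>\<in>E. w \<eta> * (f \<eta> * L h \<eta>)) =
     (\<Sum>(\<eta>, i, j)\<in>jumps. conductance \<eta> i j * (h \<eta> * f (move i j \<eta>)))
     - (\<Sum>(\<eta>, i, j)\<in>jumps. conductance \<eta> i j * (h (move i j \<eta>) * f \<eta>))"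
    unfolding sum_weight_generator sum_subtractf[symmetric]
    by (intro sum.cong) (auto simp: algebra_simps)
  also have "\<dots> = 0"
    by (simp add: sum_jumps_reverse[of "\<lambda>\<eta> \<xi>. h \<eta> * f \<xi>"])
  finally show ?thesis by simp
qed

lemma dirichlet_form:
  "2 * (\<Sum>\<eta>\<in>E. w \<eta> * (u \<eta> * L u \<eta>)) =
   - (\<Sum>(\<eta>, i, j)\<in>jumps. conductance \<eta> i j * (u (move i j \<eta>) - u \<eta>)\<^sup>2)"
proof -
  let ?S = "\<lambda>F. \<Sum>(\<eta>, i, j)\<in>jumps. conductance \<eta> i j * F \<eta> (move i j \<eta>)"
  \<comment> \<open>One copy of the form is kept and the other is written over reversed jumps;
    termwise the two add up to minus a square.\<close>
  have "2 * (\<Sum>\<eta>\<in>E. w \<eta> * (u \<eta> * L u \<eta>)) =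
      ?S (\<lambda>\<eta> \<xi>. u \<eta> * (u \<xi> - u \<eta>)) + ?S (\<lambda>\<eta> \<xi>. u \<xi> * (u \<eta> - u \<xi>))"
    using sum_jumps_reverse[of "\<lambda>\<eta> \<xi>. u \<eta> * (u \<xi> - u \<eta>)"] by (simp add: sum_weight_generator)
  also have "\<dots> = ?S (\<lambda>\<eta> \<xi>. - (u \<xi> - u \<eta>)\<^sup>2)"
    unfolding sum.distrib[symmetric]
    by (intro sum.cong) (auto simp: algebra_simps power2_eq_square)
  finally show ?thesis
    by (simp add: sum_negf[symmetric] case_prod_unfold)
qed

section \<open>Connectedness of the configuration space\<close>

lemma const_on_configs:
  assumes step: "\<And>\<eta> i j. (\<eta>, i, j) \<in> jumps \<Longrightarrow> u (move i j \<eta>) = u \<eta>"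
    and "\<eta> \<in> E"
  shows "u \<eta> = u (restrict (\<lambda>i. if i = 1 then N else 0) {1..K})"
  using \<open>\<eta> \<in> E\<close>
\<comment> \<open>The induction runs on the number of particles outside site
  \<open>1\<close>.\<close>
proof (induction "N - \<eta> 1" arbitrary: \<eta> rule: less_induct)
  case less
  have one: "1 \<in> {1..K}" using K_ge_1 by simp
  have total: "(\<Sum>i=1..K. \<eta> i) = N" using less.prems by (simp add: configs_def)
  have split: "N = \<eta> 1 + (\<Sum>i\<in>{1..K} - {1}. \<eta> i)"
    unfolding total[symmetric] using one by (intro sum.remove) auto
  show ?case
  proof (cases "\<exists>i\<in>{1..K}. i \<noteq> 1 \<and> \<eta> i \<noteq> 0")
    case True
    then obtain i where i: "i \<in> {1..K}" "i \<noteq> 1" "\<eta> i \<noteq> 0" by blast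
    \<comment> \<open>An occupied site other than \<open>1\<close> forces
      \<open>\<eta> 1 < N\<close>, so the truncated difference really drops after the jump.\<close>
    have "\<eta> i \<le> (\<Sum>i\<in>{1..K} - {1}. \<eta> i)"
      using i by (intro member_le_sum) auto
    then have "N - move i 1 \<eta> 1 < N - \<eta> 1"
      using split i by (simp add: move_def)
    moreover have "(\<eta>, i, 1) \<in> jumps"
      using i one less.prems by (simp add: jumps_def)
    ultimately show ?thesis
      using step[of \<eta> i 1] less.hyps[of "move i 1 \<eta>"] i one less.prems move_in_configs by simp
  next
    case False
    then have "\<eta> 1 = N" using split by auto
    with False have "\<eta> = restrict (\<lambda>i. if i = 1 then N else 0) {1..K}"
      using less.prems by (fastforce simp: configs_def fun_eq_iff PiE_iff extensional_def)
    then show ?thesis by simp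
  qed
qed

lemma configs_nonempty: "E \<noteq> {}"
proof -
  have "restrict (\<lambda>i. if i = 1 then N else 0) {1..K} \<in> E"
    using K_ge_1 by (simp add: configs_def)
  then show ?thesis by blast
qed

lemma sum_weight_pos: "(\<Sum>\<xi>\<in>E. w \<xi>) > 0"
  by (intro sum_pos finite_configs configs_nonempty fv_weight_pos)

section \<open>Boundedness of the generator and convergence of the exponential series\<close>

lemma generator_bound:
  obtains B where "B \<ge> 0" "\<And>f M \<eta>. (\<And>\<xi>. \<xi> \<in> E \<Longrightarrow> \<bar>f \<xi>\<bar> \<le> M) \<Longrightarrow> \<eta> \<in> E \<Longrightarrow> \<bar>L f \<eta>\<bar> \<le> B * M"
proof
  \<comment> \<open>The factor 2 comes from the triangle inequality for the increment of
    \<open>f\<close>. Summing \<open>r\<close> over the finite set \<open>E\<close> gives a constant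
    independent of \<open>f\<close> and \<open>\<eta>\<close>, which allows iteration over powers of
    \<open>L\<close>.\<close>
  define r where "r \<eta> = (\<Sum>i=1..K. real (\<eta> i) * (\<Sum>j=1..K. 2 * inflow (\<eta> j)))" for \<eta> :: "nat \<Rightarrow> nat"
  have r: "r \<eta> \<ge> 0" for \<eta>
    unfolding r_def using inflow_pos by (intro sum_nonneg mult_nonneg_nonneg) (auto simp: less_imp_le)
  show "sum r E \<ge> 0" by (intro sum_nonneg r)
  fix f :: "(nat \<Rightarrow> nat) \<Rightarrow> real" and M \<eta>
  assume f: "\<And>\<xi>. \<xi> \<in> E \<Longrightarrow> \<bar>f \<xi>\<bar> \<le> M" and \<eta>: "\<eta> \<in> E"
  have "\<bar>L f \<eta>\<bar> \<le> (\<Sum>i=1..K. real (\<eta> i) * (\<Sum>j=1..K. (2 * inflow (\<eta> j)) * M))"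
    unfolding fv_generator_def inflow_def[symmetric]
  proof (rule order.trans[OF sum_abs], rule sum_mono)
    fix i assume i: "i \<in> {1..K}"
    show "\<bar>real (\<eta> i) * (\<Sum>j=1..K. (f (move i j \<eta>) - f \<eta>) * inflow (\<eta> j))\<bar>
      \<le> real (\<eta> i) * (\<Sum>j=1..K. (2 * inflow (\<eta> j)) * M)"
    \<comment> \<open>If site \<open>i\<close> is empty, \<open>move i j \<eta>\<close> may lie
      outside \<open>E\<close>, where \<open>f\<close> is not controlled, but the factor
      \<open>\<eta> i\<close> kills the term.\<close>
    proof (cases "\<eta> i = 0")
      case False
      have "\<bar>\<Sum>j=1..K. (f (move i j \<eta>) - f \<eta>) * inflow (\<eta> j)\<bar> \<le> (\<Sum>j=1..K. (2 * inflow (\<eta> j)) * M)"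
      proof (rule order.trans[OF sum_abs], rule sum_mono)
        fix j assume j: "j \<in> {1..K}"
        have "\<bar>f (move i j \<eta>) - f \<eta>\<bar> \<le> 2 * M"
          using f[OF \<eta>] f[OF move_in_configs[of \<eta>, OF \<eta> i j False]] by linarith
        then show "\<bar>(f (move i j \<eta>) - f \<eta>) * inflow (\<eta> j)\<bar> \<le> (2 * inflow (\<eta> j)) * M"
          using inflow_pos[of "\<eta> j"] by (simp add: abs_mult mult_ac)
      qed
      then show ?thesis by (simp add: abs_mult mult_left_mono)
    qed simp
  qed
  also have "\<dots> = r \<eta> * M"
    by (simp only: r_def sum_distrib_right mult.assoc)
  also have "\<dots> \<le> sum r E * M"
    using f[OF \<eta>] \<eta> r by (intro mult_right_mono member_le_sum finite_configs) auto
  finally show "\<bar>L f \<eta>\<bar> \<le> sum r E * M" .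
qed

lemma generator_power_bound:
  obtains B M where "\<And>n \<eta>. \<eta> \<in> E \<Longrightarrow> \<bar>(L ^^ n) f \<eta>\<bar> \<le> B ^ n * M"
proof -
  obtain B where B: "B \<ge> 0"
    "\<And>f M \<eta>. (\<And>\<xi>. \<xi> \<in> E \<Longrightarrow> \<bar>f \<xi>\<bar> \<le> M) \<Longrightarrow> \<eta> \<in> E \<Longrightarrow> \<bar>L f \<eta>\<bar> \<le> B * M"
    using generator_bound by blast
  \<comment> \<open>The sum of \<open>\<bar>f \<xi>\<bar>\<close> over \<open>E\<close> serves as a
    bound for \<open>f\<close> on \<open>E\<close>.\<close>
  have "\<bar>(L ^^ n) f \<eta>\<bar> \<le> B ^ n * (\<Sum>\<xi>\<in>E. \<bar>f \<xi>\<bar>)" if "\<eta> \<in> E" for n \<eta>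
    using that
  proof (induction n arbitrary: \<eta>)
    case 0
    then show ?case by (simp add: member_le_sum[of \<eta> E "\<lambda>\<xi>. \<bar>f \<xi>\<bar>"] finite_configs)
  next
    case (Suc n)
    show ?case using B(2)[OF Suc.IH Suc.prems] by (simp add: mult_ac)
  qed
  then show thesis by (rule that)
qed

lemma semigroup_summable:
  assumes "\<eta> \<in> E"
  shows "summable (\<lambda>n. t ^ n / fact n * (L ^^ n) f \<eta>)"
proof -
  obtain B M where BM: "\<And>n \<eta>. \<eta> \<in> E \<Longrightarrow> \<bar>(L ^^ n) f \<eta>\<bar> \<le> B ^ n * M"
    using generator_power_bound by blast
  have "summable (\<lambda>n. inverse (fact n) * (\<bar>t\<bar> * B) ^ n * M)"
    by (intro summable_mult2 summable_exp)
  then show ?thesis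
  proof (rule summable_comparison_test'[where N = 0])
    fix n
    show "norm (t ^ n / fact n * (L ^^ n) f \<eta>) \<le> inverse (fact n) * (\<bar>t\<bar> * B) ^ n * M"
      using mult_left_mono[OF BM[OF assms, of n], of "\<bar>t\<bar> ^ n / fact n"]
      by (simp add: abs_mult power_abs power_mult_distrib field_simps)
  qed
qed

section \<open>Invariance under the semigroup and annihilation by the generator\<close>

lemma sum_semigroup:
  "(\<lambda>n. (\<Sum>\<eta>\<in>E. (L ^^ n) f \<eta> * m \<eta>) / fact n * t ^ n) sums
     (\<Sum>\<eta>\<in>E. fv_semigroup K N p t f \<eta> * m \<eta>)"
proof -
  have "(\<lambda>n. \<Sum>\<eta>\<in>E. t ^ n / fact n * (L ^^ n) f \<eta> * m \<eta>) sums
      (\<Sum>\<eta>\<in>E. fv_semigroup K N p t f \<eta> * m \<eta>)"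
    unfolding fv_semigroup_def
    by (intro sums_sum sums_mult2 summable_sums semigroup_summable)
  then show ?thesis
    by (simp add: sum_distrib_left sum_distrib_right sum_divide_distrib mult_ac)
qed

text \<open>Every coefficient of the power series in \<open>t\<close> beyond the constant one is a
  sum of \<open>L g\<close> against \<open>m\<close> with \<open>g = (L ^^ k) f\<close>, hence
  zero.\<close>

lemma sum_semigroup_invariant:
  assumes "\<And>f. (\<Sum>\<eta>\<in>E. L f \<eta> * m \<eta>) = 0"
  shows "(\<Sum>\<eta>\<in>E. fv_semigroup K N p t f \<eta> * m \<eta>) = (\<Sum>\<eta>\<in>E. f \<eta> * m \<eta>)"
proof -
  have "(\<lambda>n. (\<Sum>\<eta>\<in>E. (L ^^ n) f \<eta> * m \<eta>) / fact n * t ^ n) sums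
      (\<Sum>n\<in>{0}. (\<Sum>\<eta>\<in>E. (L ^^ n) f \<eta> * m \<eta>) / fact n * t ^ n)"
  proof (rule sums_finite)
    fix n :: nat assume "n \<notin> {0}"
    then obtain k where "n = Suc k" by (cases n) auto
    then show "(\<Sum>\<eta>\<in>E. (L ^^ n) f \<eta> * m \<eta>) / fact n * t ^ n = 0"
      using assms by simp
  qed simp
  from sums_unique2[OF sum_semigroup this] show ?thesis by simp
qed

lemma sum_generator_eq_0:
  assumes inv: "\<And>t. t \<ge> 0 \<Longrightarrow>
      (\<Sum>\<eta>\<in>E. fv_semigroup K N p t f \<eta> * m \<eta>) = (\<Sum>\<eta>\<in>E. f \<eta> * m \<eta>)"
  shows "(\<Sum>\<eta>\<in>E. L f \<eta> * m \<eta>) = 0"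
proof -
  define a where "a n = (\<Sum>\<eta>\<in>E. (L ^^ n) f \<eta> * m \<eta>) / fact n" for n
  have a: "(\<lambda>n. a n * t ^ n) sums (\<Sum>\<eta>\<in>E. fv_semigroup K N p t f \<eta> * m \<eta>)" for t
    unfolding a_def by (rule sum_semigroup)
  \<comment> \<open>Here \<open>K = 1\<close> instantiates a point of convergence, not the number of
    sites. The derivative at 0 is the linear coefficient \<open>a 1\<close>, the sum of
    \<open>L f\<close> against \<open>m\<close>.\<close>
  have "((\<lambda>t. \<Sum>n. a n * t ^ n) has_real_derivative (\<Sum>n. diffs a n * 0 ^ n)) (at 0)"
    by (rule termdiffs_strong[where K = 1]) (use a[of 1] in \<open>auto simp: sums_iff\<close>)
  \<comment> \<open>The series is known to be constant only for \<open>t \<ge> 0\<close>, so the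
    comparison uses one-sided derivatives.\<close>
  then have "((\<lambda>t. \<Sum>n. a n * t ^ n) has_real_derivative a 1) (at 0 within {0..})"
    by (auto simp: diffs_def intro: has_field_derivative_at_within)
  moreover have "((\<lambda>t. \<Sum>n. a n * t ^ n) has_real_derivative 0) (at 0 within {0..})"
    by (rule has_field_derivative_transform_within[where f = "\<lambda>_. \<Sum>\<eta>\<in>E. f \<eta> * m \<eta>" and d = 1])
      (use inv a in \<open>auto simp: sums_iff\<close>)
  ultimately have "a 1 = 0"
    by (rule has_field_derivative_unique) (simp add: at_within_Ici_at_right)
  then show ?thesis by (simp add: a_def)
qed

section \<open>Solutions of the stationarity equation\<close>

lemma sum_generator_weight: "(\<Sum>\<eta>\<in>E. L f \<eta> * (c * w \<eta>)) = 0"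
proof -
  have "(\<Sum>\<eta>\<in>E. w \<eta> * (1 * L f \<eta>)) = (\<Sum>\<eta>\<in>E. w \<eta> * (f \<eta> * L (\<lambda>_. 1) \<eta>))"
    by (rule generator_self_adjoint)
  also have "\<dots> = 0" by (simp add: fv_generator_def)
  finally show ?thesis
    using sum_distrib_left[of c "\<lambda>\<eta>. w \<eta> * L f \<eta>" E] by (simp add: mult_ac)
qed

lemma invariant_proportional:
  assumes inv: "\<And>f. (\<Sum>\<eta>\<in>E. L f \<eta> * m \<eta>) = 0" and total: "(\<Sum>\<eta>\<in>E. m \<eta>) = 1" and "\<eta> \<in> E"
  shows "m \<eta> = inverse (\<Sum>\<xi>\<in>E. w \<xi>) * w \<eta>"
proof -
  define u where "u \<eta> = m \<eta> / w \<eta>" for \<eta>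
  have m: "m \<eta> = w \<eta> * u \<eta>" for \<eta>
    using fv_weight_pos[of \<eta>] by (simp add: u_def)
  let ?d = "\<lambda>(\<eta>, i, j). conductance \<eta> i j * (u (move i j \<eta>) - u \<eta>)\<^sup>2"
  have pos: "conductance \<eta> i j > 0" if "(\<eta>, i, j) \<in> jumps" for \<eta> i j
    using that by (auto simp: jumps_def conductance_def fv_weight_pos inflow_pos)
  \<comment> \<open>The stationarity equation is tested with the density \<open>u\<close> itself:
    since \<open>m = w u\<close>, the left side becomes the Dirichlet form of
    \<open>u\<close>.\<close>
  have "sum ?d jumps = 0"
    using dirichlet_form[of u] inv[of u] by (simp add: m mult_ac)
  moreover have "?d x \<ge> 0" if "x \<in> jumps" for x
    using that by (cases x) (auto simp: less_imp_le[OF pos])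
  ultimately have zero: "?d x = 0" if "x \<in> jumps" for x
    using that sum_nonneg_eq_0_iff[OF finite_jumps, of ?d] by blast
  have "u (move i j \<eta>) = u \<eta>" if "(\<eta>, i, j) \<in> jumps" for \<eta> i j
    using zero[OF that] pos[OF that] by simp
  then obtain c where c: "u \<eta> = c" if "\<eta> \<in> E" for \<eta>
    using const_on_configs by blast
  \<comment> \<open>Total mass 1 fixes the constant density as the inverse of the normalizing
    constant.\<close>
  then have "(\<Sum>\<xi>\<in>E. w \<xi>) * c = 1"
    using total by (simp add: m sum_distrib_right)
  then show ?thesis
    using c[OF \<open>\<eta> \<in> E\<close>] sum_weight_pos by (simp add: m field_simps)
qed

section \<open>From weights to probability measures\<close>

lemma integral_prob_on_configs:
  assumes "prob_on_configs K N \<nu>"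
  shows "(\<integral>\<eta>. f \<eta> \<partial>\<nu>) = (\<Sum>\<eta>\<in>E. f \<eta> * measure \<nu> {\<eta>})"
  using assms
  by (intro lebesgue_integral_finite_count_space)
    (auto simp: prob_on_configs_def finite_configs prob_space.finite_measure)

lemma measure_fv_invariant:
  assumes \<nu>: "prob_on_configs K N \<nu>" "fv_invariant K N p \<nu>" and "\<eta> \<in> E"
  shows "measure \<nu> {\<eta>} = inverse (\<Sum>\<xi>\<in>E. w \<xi>) * w \<eta>"
proof (rule invariant_proportional[OF _ _ \<open>\<eta> \<in> E\<close>])
  interpret prob_space \<nu> using \<nu> by (simp add: prob_on_configs_def)
  show "(\<Sum>\<eta>\<in>E. L f \<eta> * measure \<nu> {\<eta>}) = 0" for f
    by (rule sum_generator_eq_0)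
      (use \<nu> in \<open>auto simp: fv_invariant_def integral_prob_on_configs[symmetric]\<close>)
  show "(\<Sum>\<eta>\<in>E. measure \<nu> {\<eta>}) = 1"
    using integral_prob_on_configs[OF \<nu>(1), of "\<lambda>_. 1"] prob_space by simp
qed

lemma fv_reversible_if_proportional:
  assumes "\<And>\<eta>. \<eta> \<in> E \<Longrightarrow> measure \<nu> {\<eta>} = c * w \<eta>"
  shows "fv_reversible K N p \<nu>"
  unfolding fv_reversible_def
proof (intro ballI impI)
  fix \<eta> \<xi> assume \<eta>: "\<eta> \<in> E" and \<xi>: "\<xi> \<in> E"
  \<comment> \<open>An indicator as test function selects a single state, so self-adjointness for
    two indicators is exactly detailed balance between the two states.\<close>
  have point: "(\<Sum>\<zeta>\<in>E. w \<zeta> * (indicator {x} \<zeta> * g \<zeta>)) = w x * g x" if "x \<in> E" for x and g :: "(nat \<Rightarrow> nat) \<Rightarrow> real"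
    using that sum.mono_neutral_right[of E "{x}" "\<lambda>\<zeta>. w \<zeta> * (indicator {x} \<zeta> * g \<zeta>)"]
    by (simp add: finite_configs)
  show "measure \<nu> {\<eta>} * fv_rate K N p \<eta> \<xi> = measure \<nu> {\<xi>} * fv_rate K N p \<xi> \<eta>"
    using generator_self_adjoint[of "indicator {\<eta>}" "indicator {\<xi>}"] \<eta> \<xi>
    by (simp add: point assms fv_rate_def)
qed

lemma ex_fv_invariant: "\<exists>\<nu>. prob_on_configs K N \<nu> \<and> fv_invariant K N p \<nu>"
proof -
  define c where "c = inverse (\<Sum>\<xi>\<in>E. w \<xi>)"
  have c: "c > 0" using sum_weight_pos by (simp add: c_def)
  define \<nu> where "\<nu> = point_measure E (\<lambda>\<eta>. ennreal (c * w \<eta>))"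
  have nonneg: "c * w \<eta> \<ge> 0" for \<eta> using c fv_weight_pos[of \<eta>] by simp
  have em: "emeasure \<nu> X = ennreal (\<Sum>\<eta>\<in>X. c * w \<eta>)" if "X \<subseteq> E" for X
    using that nonneg by (simp add: \<nu>_def emeasure_point_measure_finite finite_configs)
  have "(\<Sum>\<eta>\<in>E. c * w \<eta>) = 1"
    using sum_weight_pos by (simp add: c_def sum_distrib_left[symmetric])
  then have "prob_space \<nu>"
    by (intro prob_spaceI) (simp add: em[OF subset_refl] \<nu>_def[THEN arg_cong[where f = space]] space_point_measure)
  then have prob: "prob_on_configs K N \<nu>"
    by (simp add: prob_on_configs_def \<nu>_def sets_point_measure)
  have meas: "measure \<nu> {\<eta>} = c * w \<eta>" if "\<eta> \<in> E" for \<eta>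
    using that nonneg by (simp add: measure_def em)
  have "fv_invariant K N p \<nu>"
    \<comment> \<open>With atoms \<open>c * w \<eta>\<close>, stationarity holds for every test
      function and passes to the semigroup through the power series.\<close>
    unfolding fv_invariant_def integral_prob_on_configs[OF prob]
    by (simp add: meas sum_semigroup_invariant sum_generator_weight cong: sum.cong)
  with prob show ?thesis by blast
qed

lemma fv_invariant_unique:
  assumes "prob_on_configs K N \<nu>" "fv_invariant K N p \<nu>"
    and "prob_on_configs K N \<nu>'" "fv_invariant K N p \<nu>'"
  shows "\<nu> = \<nu>'"
proof (rule measure_eqI_finite[OF _ _ finite_configs[of K N]])
  fix \<eta> assume "\<eta> \<in> E"
  then show "emeasure \<nu> {\<eta>} = emeasure \<nu>' {\<eta>}"
    using assms measure_fv_invariant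
    by (simp add: prob_on_configs_def prob_space.finite_measure finite_measure.emeasure_eq_measure)
qed (use assms in \<open>simp_all add: prob_on_configs_def\<close>)

end

theorem theorem2p4:
  fixes K N :: nat and p :: real
  assumes "K \<ge> 1" and "N \<ge> 2" and "p > 0"
  shows "(\<exists>!\<nu>. prob_on_configs K N \<nu> \<and> fv_invariant K N p \<nu>) \<and>
         (\<forall>\<nu>. prob_on_configs K N \<nu> \<and> fv_invariant K N p \<nu> \<longrightarrow>
            fv_reversible K N p \<nu> \<and>
            (\<forall>\<eta>\<in>configs K N. measure \<nu> {\<eta>} =
               inverse (\<Sum>\<xi>\<in>configs K N. fv_weight K N p \<xi>) * fv_weight K N p \<eta>))"
proof -
  interpret fleming_viot K N p by unfold_locales (fact assms)+
  show ?thesis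
    \<comment> \<open>The product formula is available for any invariant probability measure;
      reversibility follows from it, with the inverse normalizing constant as
      \<open>c\<close>.\<close>
    using ex_fv_invariant fv_invariant_unique measure_fv_invariant fv_reversible_if_proportional
    by blast
qed

end
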